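(* For every real $\mu>-1$, the sequence $\{a_n(\mu)\}_{n\geq 1}$ defined by $$a_n(\mu)=2^{2n+1}(n-1)!\,(\mu+1)_n\,\zeta_{\mu}(2n)$$ is log-convex; that is, $a_n(\mu)^2\leq a_{n-1}(\mu)\,a_{n+1}(\mu)$ for all integers $n\geq 2$.
   Context: For a real number $\mu>-1$, the Bessel function of the first kind of order $\mu$ is $$J_{\mu}(z)=\left(\frac{z}{2}\right)^{\mu}\sum_{k=0}^{\infty}\frac{(-1)^k}{\Gamma(\mu+k+1)k!}\left(\frac{z}{2}\right)^{2k}.$$ It has infinitely many positive real zeros, denoted $0<j_{\mu,1}<j_{\mu,2}<j_{\mu,3}<\cdots$. The Bessel zeta function is $\zeta_{\mu}(x)=\sum_{n=1}^{\infty}\frac{1}{j_{\mu,n}^x}$ (for $x>1$). Also $(\mu+1)_n=(\mu+1)(\mu+2)\cdots(\mu+n)$. A sequence $\{a_n\}_{n\geq 1}$ of real numbers is log-convex if $a_n^2\leq a_{n-1}a_{n+1}$ for all $n\geq 2$. *)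

theory Defs
  imports "HOL-Analysis.Analysis"
begin

text \<open>
  Principal branch of the power. Note that \<open>0 powr 0 = 0\<close> in the library, so the value at
  \<open>z = 0\<close> is not the conventional one when \<open>\<mu> = 0\<close>; only positive real arguments
  are used below.
\<close>

definition bessel_J :: "real \<Rightarrow> complex \<Rightarrow> complex" where
  "bessel_J \<mu> z = (z / 2) powr (of_real \<mu>) *
     (\<Sum>k. (-1) ^ k / (Gamma (of_real \<mu> + of_nat k + 1) * fact k) * (z / 2) ^ (2 * k))"

text \<open>
  For \<open>n \<ge> 1\<close>, \<open>bessel_zero \<mu> n\<close> is the \<open>n\<close>-th positive real zero in increasing order;
  the value \<open>0\<close> at index \<open>0\<close> only starts the recursion.
\<close>

primrec bessel_zero :: "real \<Rightarrow> nat \<Rightarrow> real" where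
  "bessel_zero \<mu> 0 = 0"
| "bessel_zero \<mu> (Suc n) = (LEAST x. bessel_zero \<mu> n < x \<and> bessel_J \<mu> (of_real x) = 0)"

definition bessel_zeta :: "real \<Rightarrow> real \<Rightarrow> real" where
  "bessel_zeta \<mu> x = (\<Sum>n. 1 / bessel_zero \<mu> (Suc n) powr x)"

definition bessel_a :: "real \<Rightarrow> nat \<Rightarrow> real" where
  "bessel_a \<mu> n =
     2 ^ (2 * n + 1) * fact (n - 1) * pochhammer (\<mu> + 1) n * bessel_zeta \<mu> (real (2 * n))"

text \<open>The sequence is indexed by \<open>n \<ge> 1\<close>; the value at \<open>0\<close> plays no role.\<close>

definition log_convex_seq :: "(nat \<Rightarrow> real) \<Rightarrow> bool" where
  "log_convex_seq a \<longleftrightarrow> (\<forall>n\<ge>2. (a n)\<^sup>2 \<le> a (n - 1) * a (n + 1))"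

end

theory Submission
  imports Defs
begin

text \<open>
  Write \<open>\<sigma> n\<close> for \<open>bessel_zeta \<mu> (2 * n)\<close>, the sum of the \<open>n\<close>-th powers of the positive numbers
  \<open>1 / j\<^sup>2\<close>, with \<open>j\<close> running through the positive zeros. The Cauchy-Schwarz inequality gives
  \<open>\<sigma> n\<^sup>2 \<le> \<sigma> (n - 1) * \<sigma> (n + 1)\<close> (\<open>suminf_powers_log_convex\<close>). The remaining factors of \<open>bessel_a\<close>
  only help: the power of two is geometric in \<open>n\<close>, and the factorial and the Pochhammer symbol
  are products of increasing factors, hence log-convex.

  The analytic content is that the sums \<open>\<sigma> n\<close> converge and that the zeros they run over exist
  at all. Both follow from Sturm's comparison method. The function \<open>u x = sqrt x * J x\<close>, up to a constant
  factor, solves \<open>u'' = - q u\<close> on the positive half-line, with \<open>q x = 1 + (1/4 - \<mu>\<^sup>2) / x\<^sup>2\<close>.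
  Far out, \<open>q \<ge> 1/4\<close>, so \<open>u\<close> oscillates at least as fast as \<open>sin (x / 2)\<close> and has arbitrarily large
  zeros (\<open>zero_in_half_period\<close>). Away from the origin \<open>q\<close> is bounded, which bounds the distance
  between two zeros from below (\<open>zero_gap\<close>); near the origin there are no zeros, because the power
  series factor of \<open>J\<close> is nonzero there. Consequently the recursion that enumerates the zeros never
  fails and the \<open>n\<close>-th zero is at least \<open>n * d\<close> for some \<open>d > 0\<close> (\<open>bessel_zero_linear_growth\<close>), so
  that \<open>\<sigma> n\<close> is dominated by a multiple of the sum of \<open>1 / k ^ (2 * n)\<close>.
\<close>

section \<open>Zeros of solutions of \<open>u'' = - q u\<close>\<close>

locale second_order_ode =
  fixes u u' q :: "real \<Rightarrow> real" and I :: "real set"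
  assumes deriv_u: "\<And>x. x \<in> I \<Longrightarrow> (u has_real_derivative u' x) (at x)"
    and deriv_u': "\<And>x. x \<in> I \<Longrightarrow> (u' has_real_derivative - q x * u x) (at x)"
begin

lemma continuous_u: "S \<subseteq> I \<Longrightarrow> continuous_on S u"
  by (meson DERIV_isCont continuous_at_imp_continuous_on deriv_u subsetD)

text \<open>
  Sturm's comparison with \<open>v x = sin (\<omega> * (x - a))\<close>, which solves \<open>v'' = - \<omega>\<^sup>2 v\<close> and is nonnegative
  on the interval. The Wronskian \<open>u v' - u' v\<close> has derivative \<open>(q - \<omega>\<^sup>2) u v \<ge> 0\<close>, yet a positive
  \<open>u\<close> makes it positive at the left end and negative at the right end.
\<close>

lemma no_positive_solution_on_half_period:
  assumes \<omega>: "\<omega> > 0" and I: "{a..a + pi / \<omega>} \<subseteq> I"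
    and q: "\<And>x. x \<in> {a..a + pi / \<omega>} \<Longrightarrow> \<omega>\<^sup>2 \<le> q x"
    and pos: "\<And>x. x \<in> {a..a + pi / \<omega>} \<Longrightarrow> u x > 0"
  shows False
proof -
  define b where "b = a + pi / \<omega>"
  have ab: "a \<le> b" using \<omega> by (simp add: b_def)
  define W where "W x = u x * (\<omega> * cos (\<omega> * (x - a))) - u' x * sin (\<omega> * (x - a))" for x
  have "W a \<le> W b"
  proof (rule DERIV_nonneg_imp_nondecreasing[OF ab])
    fix x assume x: "a \<le> x" "x \<le> b"
    then have xI: "x \<in> I" "x \<in> {a..a + pi / \<omega>}" using I by (auto simp: b_def)
    have "\<omega> * (x - a) \<le> \<omega> * (pi / \<omega>)" using x \<omega> by (intro mult_left_mono) (auto simp: b_def)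
    then have "\<omega> * (x - a) \<le> pi" using \<omega> by simp
    then have "sin (\<omega> * (x - a)) \<ge> 0" using x \<omega> by (intro sin_ge_zero) auto
    then have "0 \<le> (q x - \<omega>\<^sup>2) * u x * sin (\<omega> * (x - a))"
      using q[OF xI(2)] pos[OF xI(2)] by simp
    moreover have "(W has_real_derivative (q x - \<omega>\<^sup>2) * u x * sin (\<omega> * (x - a))) (at x)"
      unfolding W_def
      by (auto intro!: derivative_eq_intros deriv_u[OF xI(1)] deriv_u'[OF xI(1)]
          simp: algebra_simps power2_eq_square)
    ultimately show "\<exists>y. (W has_real_derivative y) (at x) \<and> 0 \<le> y" by blast
  qed
  moreover have "W a > 0" using pos[of a] \<omega> by (simp add: W_def)
  moreover have "W b < 0" using pos[of b] \<omega> by (simp add: W_def b_def)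
  ultimately show False by linarith
qed

end

text \<open>
  A solution without zeros has constant sign, and the equation is invariant under \<open>u \<mapsto> - u\<close>, so
  the positive case suffices.
\<close>

lemma (in second_order_ode) zero_in_half_period:
  assumes \<omega>: "\<omega> > 0" and I: "{a..a + pi / \<omega>} \<subseteq> I"
    and q: "\<And>x. x \<in> {a..a + pi / \<omega>} \<Longrightarrow> \<omega>\<^sup>2 \<le> q x"
  shows "\<exists>x\<in>{a..a + pi / \<omega>}. u x = 0"
proof (rule ccontr)
  assume nz: "\<not> ?thesis"
  have neg: "second_order_ode (\<lambda>x. - u x) (\<lambda>x. - u' x) q I"
    by unfold_locales (auto intro!: derivative_eq_intros deriv_u deriv_u')
  have conn: "connected (u ` {a..a + pi / \<omega>})"
    using continuous_u[OF I] by (intro connected_continuous_image) auto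
  have a: "a \<in> {a..a + pi / \<omega>}" using \<omega> by simp
  consider "u a > 0" | "u a < 0" using nz a by force
  then show False
  proof cases
    case 1
    have "u x > 0" if x: "x \<in> {a..a + pi / \<omega>}" for x
    proof (rule ccontr)
      assume "\<not> u x > 0"
      then have "0 \<in> u ` {a..a + pi / \<omega>}"
        using 1 by (intro connectedD_interval[OF conn imageI[OF x] imageI[OF a]]) auto
      then show False using nz by fastforce
    qed
    then show False using no_positive_solution_on_half_period[OF \<omega> I q] by blast
  next
    case 2
    have "- u x > 0" if x: "x \<in> {a..a + pi / \<omega>}" for x
    proof (rule ccontr)
      assume "\<not> - u x > 0"
      then have "0 \<in> u ` {a..a + pi / \<omega>}"
        using 2 by (intro connectedD_interval[OF conn imageI[OF a] imageI[OF x]]) auto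
      then show False using nz by fastforce
    qed
    then show False
      using second_order_ode.no_positive_solution_on_half_period[OF neg \<omega> I q] by blast
  qed
qed

text \<open>
  This excludes common zeros of \<open>u\<close> and \<open>u'\<close>. The derivative of the energy \<open>E = u\<^sup>2 + u'\<^sup>2\<close> is
  \<open>2 (1 - q) u u'\<close>, of absolute value at most \<open>(1 + Q) E\<close>, so \<open>E\<close> times \<open>exp ((1 + Q) x)\<close> cannot
  decrease from its positive value at \<open>a\<close>.
\<close>

lemma (in second_order_ode) energy_pos:
  assumes I: "{a..} \<subseteq> I" and Q: "\<And>x. x \<ge> a \<Longrightarrow> \<bar>q x\<bar> \<le> Q" and ua: "u a \<noteq> 0" and x: "a \<le> x"
  shows "(u x)\<^sup>2 + (u' x)\<^sup>2 > 0"
proof -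
  define E where "E x = ((u x)\<^sup>2 + (u' x)\<^sup>2) * exp ((1 + Q) * x)" for x
  have "E a \<le> E x"
  proof (rule DERIV_nonneg_imp_nondecreasing[OF x])
    fix y assume y: "a \<le> y" "y \<le> x"
    then have yI: "y \<in> I" using I by auto
    have "\<bar>(1 - q y) * (2 * (u y * u' y))\<bar> \<le> (1 + Q) * ((u y)\<^sup>2 + (u' y)\<^sup>2)"
      unfolding abs_mult[of "1 - q y"]
    proof (rule mult_mono)
      have "0 \<le> (u y + u' y)\<^sup>2" "0 \<le> (u y - u' y)\<^sup>2" by simp_all
      then show "\<bar>2 * (u y * u' y)\<bar> \<le> (u y)\<^sup>2 + (u' y)\<^sup>2"
        unfolding power2_sum power2_diff by (simp add: abs_le_iff)
    qed (use Q[OF y(1)] in auto)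
    then have "0 \<le> ((1 - q y) * (2 * (u y * u' y)) + (1 + Q) * ((u y)\<^sup>2 + (u' y)\<^sup>2)) * exp ((1 + Q) * y)"
      by (intro mult_nonneg_nonneg) auto
    moreover have "(E has_real_derivative
        ((1 - q y) * (2 * (u y * u' y)) + (1 + Q) * ((u y)\<^sup>2 + (u' y)\<^sup>2)) * exp ((1 + Q) * y)) (at y)"
      unfolding E_def
      by (auto intro!: derivative_eq_intros deriv_u[OF yI] deriv_u'[OF yI]
          simp: algebra_simps power2_eq_square)
    ultimately show "\<exists>z. (E has_real_derivative z) (at y) \<and> 0 \<le> z" by blast
  qed
  moreover have "E a > 0" using ua by (simp add: E_def sum_power2_gt_zero_iff)
  ultimately have "E x > 0" by linarith
  then show ?thesis by (simp add: E_def zero_less_mult_iff)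
qed

text \<open>
  Let \<open>\<bar>u\<bar>\<close> be maximal on \<open>{s..t}\<close> at \<open>c\<close>, so that \<open>u' c = 0\<close>. Since \<open>\<bar>u''\<bar> \<le> Q * \<bar>u c\<bar>\<close> between
  the zeros, applying the mean value theorem to \<open>u\<close> and then to \<open>u'\<close> shows
  \<open>\<bar>u c\<bar> = \<bar>u c - u s\<bar> \<le> Q * (c - s)\<^sup>2 * \<bar>u c\<bar>\<close>. The factor \<open>\<bar>u c\<bar>\<close> cancels unless \<open>u\<close> vanishes
  identically on \<open>{s..t}\<close>, which the positive energy forbids; this is where \<open>u a \<noteq> 0\<close> enters.
\<close>

lemma (in second_order_ode) zero_gap:
  assumes I: "{a..} \<subseteq> I" and Q: "\<And>x. x \<ge> a \<Longrightarrow> \<bar>q x\<bar> \<le> Q" and ua: "u a \<noteq> 0"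
    and st: "a \<le> s" "s < t" "u s = 0" "u t = 0"
  shows "1 < Q * (t - s)\<^sup>2"
proof -
  have sub: "{s..t} \<subseteq> I" using I st by auto
  (* the square has the same maxima as the absolute value and is differentiable *)
  have "\<exists>c\<in>{s..t}. \<forall>y\<in>{s..t}. (u y)\<^sup>2 \<le> (u c)\<^sup>2"
    using st continuous_u[OF sub]
    by (intro continuous_attains_sup) (auto intro!: continuous_intros)
  then obtain c where c: "c \<in> {s..t}" and max: "\<And>y. y \<in> {s..t} \<Longrightarrow> (u y)\<^sup>2 \<le> (u c)\<^sup>2"
    by blast
  have uc: "u c \<noteq> 0"
  proof
    assume "u c = 0"
    then have z: "u y = 0" if "y \<in> {s..t}" for y using max[OF that] by simp
    define m where "m = (s + t) / 2"
    have m: "s < m" "m < t" using st by (auto simp: m_def field_simps)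
    have "u' m = 0"
    proof (rule DERIV_local_const[OF deriv_u])
      show "m \<in> I" using m sub by auto
      show "0 < (t - s) / 2" using st by simp
      show "\<forall>y. \<bar>m - y\<bar> < (t - s) / 2 \<longrightarrow> u m = u y"
        using m by (auto simp: m_def abs_if field_simps z split: if_splits)
    qed
    then show False using energy_pos[OF I Q ua, of m] z[of m] m st by auto
  qed
  then have c': "s < c" "c < t" using c st by (auto simp: less_le)
  have cI: "c \<in> I" using c sub by auto
  have "2 * u c * u' c = 0"
  proof (rule DERIV_local_max)
    show "((\<lambda>x. (u x)\<^sup>2) has_real_derivative 2 * u c * u' c) (at c)"
      by (auto intro!: derivative_eq_intros deriv_u[OF cI])
    show "0 < min (c - s) (t - c)" using c' by simp
    show "\<forall>y. \<bar>c - y\<bar> < min (c - s) (t - c) \<longrightarrow> (u y)\<^sup>2 \<le> (u c)\<^sup>2"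
      by (auto intro!: max simp: abs_if split: if_splits)
  qed
  then have u'c: "u' c = 0" using uc by simp
  obtain y where y: "s < y" "y < c" "u c - u s = (c - s) * u' y"
  proof -
    have "\<exists>z>s. z < c \<and> u c - u s = (c - s) * u' z"
      using sub c' by (intro MVT2 deriv_u) auto
    then show ?thesis using that by blast
  qed
  obtain z where z: "y < z" "z < c" "u' c - u' y = (c - y) * (- q z * u z)"
  proof -
    have "\<exists>z>y. z < c \<and> u' c - u' y = (c - y) * (- q z * u z)"
      using sub c' y by (intro MVT2 deriv_u') auto
    then show ?thesis using that by blast
  qed
  have uz: "\<bar>u z\<bar> \<le> \<bar>u c\<bar>"
    using max[of z] y z c' by (simp add: abs_le_square_iff)
  have Q0: "0 \<le> Q" using Q[of a] by force
  have "\<bar>u c\<bar> = (c - s) * (c - y) * (\<bar>q z\<bar> * \<bar>u z\<bar>)"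
  proof -
    have "u c = (c - s) * (c - y) * (q z * u z)" using y z u'c st by simp
    then show ?thesis using y c' by (simp add: abs_mult)
  qed
  also have "\<dots> \<le> (c - s) * (c - s) * (Q * \<bar>u c\<bar>)"
    using y z c' uz Q[of z] Q0 st by (intro mult_mono) auto
  finally have "1 \<le> Q * (c - s)\<^sup>2"
    using uc by (simp add: power2_eq_square mult.assoc[symmetric] mult.commute[of _ Q])
  moreover from this have "Q > 0" using Q0 by (cases "Q = 0") auto
  moreover have "(c - s)\<^sup>2 < (t - s)\<^sup>2" using c' by (intro power_strict_mono) auto
  ultimately show ?thesis by (smt (verit) mult_strict_left_mono)
qed

section \<open>The power series of the Bessel function\<close>

definition bessel_coeff :: "real \<Rightarrow> nat \<Rightarrow> real" where
  "bessel_coeff \<mu> k = (-1) ^ k / (Gamma (\<mu> + real k + 1) * fact k)"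

text \<open>
  The argument stands for \<open>x\<^sup>2 / 4\<close>, so that \<open>J x\<close> is \<open>(x / 2) powr \<mu>\<close> times the value of the series.
\<close>

definition bessel_series :: "real \<Rightarrow> real \<Rightarrow> real" where
  "bessel_series \<mu> w = (\<Sum>k. bessel_coeff \<mu> k * w ^ k)"

lemma bessel_coeff_Suc:
  assumes "\<mu> > -1"
  shows "real (Suc k) * (\<mu> + real k + 1) * bessel_coeff \<mu> (Suc k) = - bessel_coeff \<mu> k"
proof -
  have pos: "\<mu> + real k + 1 > 0" using assms by simp
  have "Gamma (\<mu> + real (Suc k) + 1) = (\<mu> + real k + 1) * Gamma (\<mu> + real k + 1)"
    using Gamma_plus1[of "\<mu> + real k + 1"] pos nonpos_Ints_nonpos
    by (fastforce simp: algebra_simps)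
  moreover have "Gamma (\<mu> + real k + 1) > 0" using pos by (rule Gamma_real_pos)
  ultimately show ?thesis
    using pos by (simp add: bessel_coeff_def divide_simps del: of_nat_Suc)
qed

lemma summable_bessel_coeff:
  assumes "\<mu> > -1"
  shows "summable (\<lambda>k. bessel_coeff \<mu> k * w ^ k)"
proof (rule summable_ratio_test)
  (* from this index on the ratio of consecutive terms, |w| / ((k + 1) (mu + k + 1)), is at
     most 1/2; the summand 1 ensures mu + k + 1 >= 1 *)
  fix k assume k: "k \<ge> nat \<lceil>2 * \<bar>w\<bar>\<rceil> + 1"
  have w: "\<bar>w\<bar> \<le> real (Suc k) / 2"
  proof -
    have "2 * \<bar>w\<bar> \<le> real (nat \<lceil>2 * \<bar>w\<bar>\<rceil>)" by (rule real_nat_ceiling_ge)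
    also have "\<dots> \<le> real (Suc k)" using k by simp
    finally show ?thesis by simp
  qed
  have "real k \<ge> 1" using k by linarith
  then have k1: "\<mu> + real k + 1 \<ge> 1" using assms by linarith
  have "real (Suc k) * \<bar>bessel_coeff \<mu> (Suc k)\<bar>
      \<le> \<bar>real (Suc k) * (\<mu> + real k + 1) * bessel_coeff \<mu> (Suc k)\<bar>"
    using mult_right_mono[OF k1, of "real (Suc k) * \<bar>bessel_coeff \<mu> (Suc k)\<bar>"] k1
    by (simp add: abs_mult mult_ac del: of_nat_Suc)
  then have "real (Suc k) * \<bar>bessel_coeff \<mu> (Suc k)\<bar> \<le> \<bar>bessel_coeff \<mu> k\<bar>"
    unfolding bessel_coeff_Suc[OF assms] by simp
  moreover have "\<bar>w\<bar> * \<bar>bessel_coeff \<mu> (Suc k)\<bar> \<le> real (Suc k) / 2 * \<bar>bessel_coeff \<mu> (Suc k)\<bar>"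
    using w by (intro mult_right_mono) auto
  ultimately have "\<bar>w\<bar> * \<bar>bessel_coeff \<mu> (Suc k)\<bar> \<le> 1 / 2 * \<bar>bessel_coeff \<mu> k\<bar>" by linarith
  then have "\<bar>w\<bar> * \<bar>bessel_coeff \<mu> (Suc k)\<bar> * \<bar>w ^ k\<bar> \<le> 1 / 2 * \<bar>bessel_coeff \<mu> k\<bar> * \<bar>w ^ k\<bar>"
    by (rule mult_right_mono) simp
  then show "norm (bessel_coeff \<mu> (Suc k) * w ^ Suc k) \<le> 1 / 2 * norm (bessel_coeff \<mu> k * w ^ k)"
    by (simp add: abs_mult mult_ac)
qed simp

text \<open>
  The differential equation compares coefficients: that of \<open>w ^ n\<close> on the left-hand side is
  \<open>(n + 1) (\<mu> + n + 1) c (n + 1) + c n\<close>, which is zero by the recurrence of the coefficients.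
\<close>

lemma bessel_series_ode:
  assumes "\<mu> > -1"
  obtains F' F'' where
    "\<And>w. (bessel_series \<mu> has_real_derivative F' w) (at w)"
    "\<And>w. (F' has_real_derivative F'' w) (at w)"
    "\<And>w. w * F'' w + (\<mu> + 1) * F' w + bessel_series \<mu> w = 0"
proof
  let ?c = "bessel_coeff \<mu>"
  let ?F' = "\<lambda>w. \<Sum>n. diffs ?c n * w ^ n" and ?F'' = "\<lambda>w. \<Sum>n. diffs (diffs ?c) n * w ^ n"
  have s0: "summable (\<lambda>n. ?c n * w ^ n)" for w by (rule summable_bessel_coeff[OF assms])
  have s1: "summable (\<lambda>n. diffs ?c n * w ^ n)" for w by (rule termdiff_converges_all[OF s0])
  have s2: "summable (\<lambda>n. diffs (diffs ?c) n * w ^ n)" for w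
    by (rule termdiff_converges_all[OF s1])
  show "(bessel_series \<mu> has_real_derivative ?F' w) (at w)" for w
    unfolding bessel_series_def[abs_def]
    by (rule termdiffs_strong_converges_everywhere[OF s0])
  show "(?F' has_real_derivative ?F'' w) (at w)" for w
    by (rule termdiffs_strong_converges_everywhere[OF s1])
  show "w * ?F'' w + (\<mu> + 1) * ?F' w + bessel_series \<mu> w = 0" for w
  proof -
    have "(\<lambda>n. real n * diffs ?c n * w ^ n) sums (w * ?F'' w)"
    proof -
      have "(\<lambda>n. w * (diffs (diffs ?c) n * w ^ n)) sums (w * ?F'' w)"
        by (intro sums_mult summable_sums s2)
      then have "(\<lambda>n. real (Suc n) * diffs ?c (Suc n) * w ^ Suc n) sums (w * ?F'' w)"
        by (simp add: diffs_def mult_ac del: of_nat_Suc)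
      then show ?thesis by (subst (asm) sums_Suc_iff) simp
    qed
    then have "(\<lambda>n. real n * diffs ?c n * w ^ n + (\<mu> + 1) * (diffs ?c n * w ^ n) + ?c n * w ^ n)
        sums (w * ?F'' w + (\<mu> + 1) * ?F' w + bessel_series \<mu> w)"
      unfolding bessel_series_def by (intro sums_add sums_mult summable_sums s0 s1)
    moreover have "real n * diffs ?c n * w ^ n + (\<mu> + 1) * (diffs ?c n * w ^ n) + ?c n * w ^ n = 0" for n
    proof -
      have "real n * diffs ?c n * w ^ n + (\<mu> + 1) * (diffs ?c n * w ^ n) + ?c n * w ^ n
          = (real (Suc n) * (\<mu> + real n + 1) * ?c (Suc n) + ?c n) * w ^ n"
        by (simp add: diffs_def algebra_simps)
      then show ?thesis unfolding bessel_coeff_Suc[OF assms] by simp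
    qed
    ultimately show ?thesis by (simp add: sums_iff)
  qed
qed

lemma bessel_J_eq_0_iff:
  assumes "\<mu> > -1" "x > 0"
  shows "bessel_J \<mu> (of_real x) = 0 \<longleftrightarrow> bessel_series \<mu> (x\<^sup>2 / 4) = 0"
proof -
  have eq: "(-1) ^ k / (Gamma (of_real \<mu> + of_nat k + 1) * fact k) * (complex_of_real x / 2) ^ (2 * k)
      = of_real (bessel_coeff \<mu> k * (x\<^sup>2 / 4) ^ k)" for k
  proof -
    have "Gamma (complex_of_real \<mu> + of_nat k + 1) = of_real (Gamma (\<mu> + real k + 1))"
      by (subst Gamma_complex_of_real[symmetric]) simp
    then show ?thesis
      by (simp add: bessel_coeff_def power_mult power_divide)
  qed
  have "(\<Sum>k. (-1) ^ k / (Gamma (of_real \<mu> + of_nat k + 1) * fact k) * (complex_of_real x / 2) ^ (2 * k))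
      = of_real (bessel_series \<mu> (x\<^sup>2 / 4))"
    unfolding eq bessel_series_def by (intro suminf_of_real[symmetric] summable_bessel_coeff assms)
  then show ?thesis using assms(2) by (simp add: bessel_J_def)
qed

text \<open>
  This is \<open>2 powr \<mu> * sqrt x * J x\<close> for \<open>x > 0\<close>: the factor \<open>sqrt x\<close> removes the first-order term
  from Bessel's equation.
\<close>

definition bessel_u :: "real \<Rightarrow> real \<Rightarrow> real" where
  "bessel_u \<mu> x = x powr (\<mu> + 1 / 2) * bessel_series \<mu> (x\<^sup>2 / 4)"

lemma bessel_u_ode:
  assumes "\<mu> > -1"
  obtains u' where "second_order_ode (bessel_u \<mu>) u' (\<lambda>x. 1 + (1 / 4 - \<mu>\<^sup>2) / x\<^sup>2) {0<..}"
proof -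
  obtain F' F'' where F: "\<And>w. (bessel_series \<mu> has_real_derivative F' w) (at w)"
    and F': "\<And>w. (F' has_real_derivative F'' w) (at w)"
    and ode: "\<And>w. w * F'' w + (\<mu> + 1) * F' w + bessel_series \<mu> w = 0"
    using bessel_series_ode[OF assms] by metis
  note F2 = DERIV_chain2[OF F] and F'2 = DERIV_chain2[OF F']
  define u' where "u' x = (\<mu> + 1 / 2) * x powr (\<mu> - 1 / 2) * bessel_series \<mu> (x\<^sup>2 / 4)
      + x powr (\<mu> + 3 / 2) / 2 * F' (x\<^sup>2 / 4)" for x
  have "second_order_ode (bessel_u \<mu>) u' (\<lambda>x. 1 + (1 / 4 - \<mu>\<^sup>2) / x\<^sup>2) {0<..}"
  proof
    fix x :: real assume "x \<in> {0<..}"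
    then have x: "x > 0" by simp
    (* all occurring powers of x are P times a natural power, which leaves polynomial identities *)
    define P where "P = x powr (\<mu> - 3 / 2)"
    have shift: "x powr (\<mu> - 3 / 2 + real n) = P * x ^ n" for n
      using x by (simp add: P_def powr_add powr_realpow)
    have p: "x powr (\<mu> - 1 / 2) = P * x" "x powr (\<mu> + 1 / 2) = P * x ^ 2"
      "x powr (\<mu> + 3 / 2) = P * x ^ 3"
      using shift[of 1] shift[of 2] shift[of 3] by (simp_all add: algebra_simps)
    show "(bessel_u \<mu> has_real_derivative u' x) (at x)"
      unfolding bessel_u_def[abs_def] u'_def
      using x by (auto intro!: derivative_eq_intros F2 simp: p algebra_simps power2_eq_square power3_eq_cube)
    have "(u' has_real_derivative
        (\<mu> + 1 / 2) * ((\<mu> - 1 / 2) * P * bessel_series \<mu> (x\<^sup>2 / 4) + P * x * (F' (x\<^sup>2 / 4) * (x / 2)))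
        + ((\<mu> + 3 / 2) * (P * x ^ 2) / 2 * F' (x\<^sup>2 / 4) + P * x ^ 3 / 2 * (F'' (x\<^sup>2 / 4) * (x / 2)))) (at x)"
      (is "(_ has_real_derivative ?D) _")
      unfolding u'_def[abs_def]
      using x by (auto intro!: derivative_eq_intros F2 F'2 simp: p P_def[symmetric] algebra_simps)
        (simp add: field_simps power2_eq_square power3_eq_cube)
    moreover have "?D = - (1 + (1 / 4 - \<mu>\<^sup>2) / x\<^sup>2) * bessel_u \<mu> x"
    proof -
      define f f1 f2 where "f = bessel_series \<mu> (x\<^sup>2 / 4)" and "f1 = F' (x\<^sup>2 / 4)"
        and "f2 = F'' (x\<^sup>2 / 4)"
      have "?D - - (1 + (1 / 4 - \<mu>\<^sup>2) / x\<^sup>2) * (P * x ^ 2 * f)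
          = P * x ^ 2 * (x\<^sup>2 / 4 * f2 + (\<mu> + 1) * f1 + f)"
        unfolding f_def[symmetric] f1_def[symmetric] f2_def[symmetric]
        using x by (simp add: field_simps power2_eq_square power3_eq_cube)
      also have "\<dots> = 0" using ode[of "x\<^sup>2 / 4"] by (simp add: f_def f1_def f2_def)
      finally show ?thesis by (simp add: bessel_u_def p f_def)
    qed
    ultimately show "(u' has_real_derivative - (1 + (1 / 4 - \<mu>\<^sup>2) / x\<^sup>2) * bessel_u \<mu> x) (at x)"
      by simp
  qed
  then show ?thesis by (rule that)
qed

section \<open>The positive zeros of the Bessel function\<close>

lemma bessel_u_eq_0_iff:
  assumes "\<mu> > -1" "x > 0"
  shows "bessel_u \<mu> x = 0 \<longleftrightarrow> bessel_J \<mu> (of_real x) = 0"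
  using assms by (simp add: bessel_J_eq_0_iff bessel_u_def)

lemma bessel_J_zeros_unbounded:
  assumes "\<mu> > -1"
  shows "\<exists>x>b. bessel_J \<mu> (of_real x) = 0"
proof -
  obtain u' where "second_order_ode (bessel_u \<mu>) u' (\<lambda>x. 1 + (1 / 4 - \<mu>\<^sup>2) / x\<^sup>2) {0<..}"
    using bessel_u_ode[OF assms] .
  then interpret second_order_ode "bessel_u \<mu>" u' "\<lambda>x. 1 + (1 / 4 - \<mu>\<^sup>2) / x\<^sup>2" "{0<..}" .
  (* beyond 2 |mu| the quotient mu^2 / x^2 is at most 1/4, so q >= 3/4, more than (1/2)^2 *)
  define a where "a = \<bar>b\<bar> + 2 * \<bar>\<mu>\<bar> + 1"
  have "\<exists>x\<in>{a..a + pi / (1 / 2)}. bessel_u \<mu> x = 0"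
  proof (rule zero_in_half_period)
    show "{a..a + pi / (1 / 2)} \<subseteq> {0<..}" by (auto simp: a_def)
    fix x assume "x \<in> {a..a + pi / (1 / 2)}"
    then have x: "x \<ge> 2 * \<bar>\<mu>\<bar>" "x > 0" by (auto simp: a_def)
    then have "(2 * \<bar>\<mu>\<bar>)\<^sup>2 \<le> x\<^sup>2" by (intro power_mono) auto
    then have "4 * \<mu>\<^sup>2 \<le> x\<^sup>2" by (simp add: power_mult_distrib)
    then have "- 1 / 4 * x\<^sup>2 \<le> 1 / 4 - \<mu>\<^sup>2" by (simp add: field_simps)
    then have "- 1 / 4 \<le> (1 / 4 - \<mu>\<^sup>2) / x\<^sup>2"
      using x by (subst pos_le_divide_eq) auto
    moreover have "(1 / 2 :: real)\<^sup>2 = 1 / 4" by (simp add: power2_eq_square)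
    ultimately show "(1 / 2)\<^sup>2 \<le> 1 + (1 / 4 - \<mu>\<^sup>2) / x\<^sup>2" by linarith
  qed simp
  then obtain x where "x \<ge> a" "bessel_u \<mu> x = 0" by auto
  moreover have "x > 0" "x > b" using \<open>x \<ge> a\<close> by (auto simp: a_def)
  ultimately show ?thesis using bessel_u_eq_0_iff[OF assms] by blast
qed

text \<open>
  The series is nonzero at the origin and continuous, hence nonzero up to some \<open>a > 0\<close>; beyond \<open>a\<close> the
  function \<open>q\<close> is bounded by some \<open>Q \<ge> 1\<close> and the gap between zeros exceeds \<open>1 / sqrt Q \<ge> 1 / Q\<close>.
\<close>

lemma bessel_J_zeros_separated:
  assumes "\<mu> > -1"
  obtains d where "d > 0" "\<And>x. x > 0 \<Longrightarrow> bessel_J \<mu> (of_real x) = 0 \<Longrightarrow> d \<le> x"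
    "\<And>x y. 0 < x \<Longrightarrow> x < y \<Longrightarrow> bessel_J \<mu> (of_real x) = 0 \<Longrightarrow> bessel_J \<mu> (of_real y) = 0
      \<Longrightarrow> x + d \<le> y"
proof -
  obtain u' where "second_order_ode (bessel_u \<mu>) u' (\<lambda>x. 1 + (1 / 4 - \<mu>\<^sup>2) / x\<^sup>2) {0<..}"
    using bessel_u_ode[OF assms] .
  then interpret second_order_ode "bessel_u \<mu>" u' "\<lambda>x. 1 + (1 / 4 - \<mu>\<^sup>2) / x\<^sup>2" "{0<..}" .
  have "isCont (bessel_series \<mu>) w" for w
    by (rule bessel_series_ode[OF assms]) (rule DERIV_isCont)
  then have cont: "isCont (\<lambda>x. bessel_series \<mu> (x\<^sup>2 / 4)) 0"
    by (rule isCont_o2[rotated]) (intro continuous_intros, simp)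
  have "bessel_series \<mu> 0 = bessel_coeff \<mu> 0"
    unfolding bessel_series_def using powser_zero[of "bessel_coeff \<mu>"] by simp
  moreover have "Gamma (\<mu> + 1) > 0" using assms by (intro Gamma_real_pos) simp
  ultimately have "bessel_series \<mu> (0\<^sup>2 / 4) \<noteq> 0" by (simp add: bessel_coeff_def)
  from continuous_at_avoid[OF cont this]
  obtain \<delta> where \<delta>: "\<delta> > 0" "\<And>x. \<bar>x\<bar> < \<delta> \<Longrightarrow> bessel_series \<mu> (x\<^sup>2 / 4) \<noteq> 0"
    by (auto simp: dist_real_def)
  define a where "a = \<delta> / 2"
  define Q where "Q = 1 + \<bar>1 / 4 - \<mu>\<^sup>2\<bar> / a\<^sup>2"
  have a: "a > 0" using \<delta> by (simp add: a_def)
  have low: "a \<le> x" if "x > 0" "bessel_J \<mu> (of_real x) = 0" for x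
    using \<delta>(2)[of x] that bessel_J_eq_0_iff[OF assms, of x] \<delta>(1)
    by (cases "x < \<delta>") (auto simp: a_def)
  have Q1: "Q \<ge> 1" by (simp add: Q_def)
  have gap: "1 < Q * (y - x)\<^sup>2"
    if "0 < x" "x < y" "bessel_J \<mu> (of_real x) = 0" "bessel_J \<mu> (of_real y) = 0" for x y
  proof (rule zero_gap)
    show "{a..} \<subseteq> {0<..}" using a by auto
    show "bessel_u \<mu> a \<noteq> 0" using \<delta> by (simp add: bessel_u_def a_def)
    show "a \<le> x" using low that by blast
    show "bessel_u \<mu> x = 0" "bessel_u \<mu> y = 0"
      using that bessel_u_eq_0_iff[OF assms] by auto
    fix z assume z: "a \<le> z"
    have "\<bar>1 / 4 - \<mu>\<^sup>2\<bar> / z\<^sup>2 \<le> \<bar>1 / 4 - \<mu>\<^sup>2\<bar> / a\<^sup>2"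
      using z a by (intro divide_left_mono power_mono) auto
    moreover have "\<bar>1 + (1 / 4 - \<mu>\<^sup>2) / z\<^sup>2\<bar> \<le> 1 + \<bar>(1 / 4 - \<mu>\<^sup>2) / z\<^sup>2\<bar>"
      by linarith
    ultimately show "\<bar>1 + (1 / 4 - \<mu>\<^sup>2) / z\<^sup>2\<bar> \<le> Q"
      by (simp add: Q_def abs_divide)
  qed (use that in auto)
  show ?thesis
  proof (rule that[of "min a (1 / Q)"])
    show "min a (1 / Q) > 0" using a Q1 by simp
    show "min a (1 / Q) \<le> x" if "x > 0" "bessel_J \<mu> (of_real x) = 0" for x
      using low[OF that] by simp
    show "x + min a (1 / Q) \<le> y"
      if "0 < x" "x < y" "bessel_J \<mu> (of_real x) = 0" "bessel_J \<mu> (of_real y) = 0" for x y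
    proof -
      have "1 / Q \<le> y - x"
      proof (rule ccontr)
        assume "\<not> ?thesis"
        then have "(y - x)\<^sup>2 \<le> (1 / Q)\<^sup>2" using that by (intro power_mono) auto
        then have "Q * (y - x)\<^sup>2 \<le> Q * (1 / Q)\<^sup>2" using Q1 by (intro mult_left_mono) auto
        also have "\<dots> \<le> 1" using Q1 by (simp add: power2_eq_square)
        finally show False using gap[OF that] by simp
      qed
      then show ?thesis by linarith
    qed
  qed
qed

text \<open>
  Within distance \<open>d\<close> above the infimum lies exactly one such point, hence the minimum.
\<close>

lemma Least_of_separated:
  fixes P :: "real \<Rightarrow> bool"
  assumes "d > 0" and sep: "\<And>x y. P x \<Longrightarrow> P y \<Longrightarrow> x < y \<Longrightarrow> x + d \<le> y"
    and ex: "\<exists>x. P x" and bdd: "\<And>x. P x \<Longrightarrow> b \<le> x"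
  shows "P (LEAST x. P x)"
proof -
  have ne: "{x. P x} \<noteq> {}" and bd: "bdd_below {x. P x}"
    using ex bdd by (auto intro!: bdd_belowI[where m = b])
  obtain x where x: "P x" "x < Inf {x. P x} + d"
    using cInf_lessD[OF ne, of "Inf {x. P x} + d"] \<open>d > 0\<close> by auto
  have "x \<le> y" if "P y" for y
    using sep[OF that x(1)] cInf_lower[OF _ bd, of y] that x(2) by force
  then have "(LEAST x. P x) = x" using x(1) by (intro Least_equality)
  then show ?thesis using x(1) by simp
qed

lemma bessel_zero_linear_growth:
  assumes "\<mu> > -1"
  obtains d where "d > 0" "\<And>n. real n * d \<le> bessel_zero \<mu> n"
proof -
  obtain d where d: "d > 0" and low: "\<And>x. x > 0 \<Longrightarrow> bessel_J \<mu> (of_real x) = 0 \<Longrightarrow> d \<le> x"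
    and sep: "\<And>x y. 0 < x \<Longrightarrow> x < y \<Longrightarrow> bessel_J \<mu> (of_real x) = 0 \<Longrightarrow> bessel_J \<mu> (of_real y) = 0
      \<Longrightarrow> x + d \<le> y"
    using bessel_J_zeros_separated[OF assms] by metis
  have step: "bessel_zero \<mu> n < bessel_zero \<mu> (Suc n) \<and> bessel_J \<mu> (of_real (bessel_zero \<mu> (Suc n))) = 0"
    if "0 \<le> bessel_zero \<mu> n" for n
    unfolding bessel_zero.simps(2)
    by (rule Least_of_separated[OF d, where b = "bessel_zero \<mu> n"])
      (use that sep bessel_J_zeros_unbounded[OF assms] in auto)
  have "0 \<le> bessel_zero \<mu> n" for n
    by (induction n) (use step in force)+
  note step = step[OF this]
  have pos: "0 < bessel_zero \<mu> (Suc n)" for n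
    using step \<open>\<And>n. 0 \<le> bessel_zero \<mu> n\<close> by (metis order.strict_trans1)
  have "real n * d \<le> bessel_zero \<mu> n" for n
  proof (induction n)
    case (Suc n)
    have "bessel_zero \<mu> n + d \<le> bessel_zero \<mu> (Suc n)"
    proof (cases n)
      case 0
      then show ?thesis using low[OF pos[of 0]] step[of 0] by (simp del: bessel_zero.simps(2))
    next
      case (Suc m)
      then show ?thesis using sep pos step by blast
    qed
    then show ?case using Suc.IH by (simp add: algebra_simps del: bessel_zero.simps(2))
  qed simp
  with d show ?thesis by (rule that)
qed

lemma bessel_zero_pos:
  assumes "\<mu> > -1"
  shows "bessel_zero \<mu> (Suc n) > 0"
proof -
  obtain d where d: "d > 0" "\<And>n. real n * d \<le> bessel_zero \<mu> n"
    using bessel_zero_linear_growth[OF assms] by metis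
  have "0 < real (Suc n) * d" using d(1) by simp
  then show ?thesis using d(2)[of "Suc n"] by linarith
qed

lemma summable_bessel_zero_powers:
  assumes "\<mu> > -1"
  shows "summable (\<lambda>k. (1 / (bessel_zero \<mu> (Suc k))\<^sup>2) ^ Suc n)"
proof -
  obtain d where d: "d > 0" "\<And>n. real n * d \<le> bessel_zero \<mu> n"
    using bessel_zero_linear_growth[OF assms] by metis
  have "summable (\<lambda>k. 1 / real k ^ (2 * Suc n))" using inverse_power_summable[of "2 * Suc n", where ?'a = real] by (simp add: inverse_eq_divide)
  then have "summable (\<lambda>k. 1 / real (Suc k) ^ (2 * Suc n))" by (subst summable_Suc_iff)
  then have "summable (\<lambda>k. 1 / d ^ (2 * Suc n) * (1 / real (Suc k) ^ (2 * Suc n)))"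
    by (rule summable_mult)
  then show ?thesis
  proof (rule summable_comparison_test'[where N = 0])
    fix k :: nat
    have "(real (Suc k) * d) ^ (2 * Suc n) \<le> bessel_zero \<mu> (Suc k) ^ (2 * Suc n)"
      using d by (intro power_mono) (simp_all del: bessel_zero.simps of_nat_Suc)
    moreover have "0 < (real (Suc k) * d) ^ (2 * Suc n)" using d by simp
    ultimately have "1 / bessel_zero \<mu> (Suc k) ^ (2 * Suc n) \<le> 1 / (real (Suc k) * d) ^ (2 * Suc n)"
      by (intro divide_left_mono mult_pos_pos) auto
    then have "(1 / (bessel_zero \<mu> (Suc k))\<^sup>2) ^ Suc n \<le> 1 / (real (Suc k) * d) ^ (2 * Suc n)"
      by (simp only: power_one_over power_mult[symmetric])
    moreover have "0 \<le> (1 / (bessel_zero \<mu> (Suc k))\<^sup>2) ^ Suc n" by simp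
    ultimately show "norm ((1 / (bessel_zero \<mu> (Suc k))\<^sup>2) ^ Suc n)
        \<le> 1 / d ^ (2 * Suc n) * (1 / real (Suc k) ^ (2 * Suc n))"
      by (simp only: real_norm_def abs_of_nonneg power_mult_distrib mult.commute times_divide_times_eq mult_1)
  qed
qed

lemma bessel_zeta_even:
  assumes "\<mu> > -1"
  shows "bessel_zeta \<mu> (real (2 * n)) = (\<Sum>k. (1 / (bessel_zero \<mu> (Suc k))\<^sup>2) ^ n)"
proof -
  have "1 / bessel_zero \<mu> (Suc k) powr real (2 * n) = (1 / (bessel_zero \<mu> (Suc k))\<^sup>2) ^ n" for k
    using bessel_zero_pos[OF assms, of k]
    by (simp only: powr_realpow power_one_over power_mult)
  then show ?thesis by (simp only: bessel_zeta_def)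
qed

section \<open>Log-convexity\<close>

text \<open>
  With \<open>A\<close>, \<open>B\<close>, \<open>C\<close> the three sums in order of the exponents, the sum of the nonnegative terms
  \<open>f k ^ m * (A * f k - B)\<^sup>2\<close> is \<open>A * (A * C - B\<^sup>2)\<close>, and \<open>A > 0\<close>.
\<close>

lemma suminf_powers_log_convex:
  fixes f :: "nat \<Rightarrow> real"
  assumes pos: "\<And>k. f k > 0"
    and sm: "summable (\<lambda>k. f k ^ m)" "summable (\<lambda>k. f k ^ Suc m)" "summable (\<lambda>k. f k ^ Suc (Suc m))"
  shows "(\<Sum>k. f k ^ Suc m)\<^sup>2 \<le> (\<Sum>k. f k ^ m) * (\<Sum>k. f k ^ Suc (Suc m))"
proof -
  define A B C where "A = (\<Sum>k. f k ^ m)" and "B = (\<Sum>k. f k ^ Suc m)"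
    and "C = (\<Sum>k. f k ^ Suc (Suc m))"
  have "(\<lambda>k. A\<^sup>2 * f k ^ Suc (Suc m) - 2 * A * B * f k ^ Suc m + B\<^sup>2 * f k ^ m)
      sums (A\<^sup>2 * C - 2 * A * B * B + B\<^sup>2 * A)"
    unfolding A_def B_def C_def by (intro sums_add sums_diff sums_mult summable_sums sm)
  moreover have "A\<^sup>2 * f k ^ Suc (Suc m) - 2 * A * B * f k ^ Suc m + B\<^sup>2 * f k ^ m
      = f k ^ m * (A * f k - B)\<^sup>2" for k
    by (simp add: algebra_simps power2_eq_square)
  ultimately have "(\<lambda>k. f k ^ m * (A * f k - B)\<^sup>2) sums (A\<^sup>2 * C - 2 * A * B * B + B\<^sup>2 * A)"
    by simp
  then have "0 \<le> A\<^sup>2 * C - 2 * A * B * B + B\<^sup>2 * A"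
    by (rule sums_le[OF _ sums_zero, rotated]) (simp add: pos less_imp_le)
  then have "0 \<le> A * (A * C - B\<^sup>2)" by (simp add: algebra_simps power2_eq_square)
  moreover have "A > 0" unfolding A_def using pos by (intro suminf_pos sm) auto
  ultimately show ?thesis by (simp add: zero_le_mult_iff A_def B_def C_def)
qed

theorem theorem4p2:
  fixes \<mu> :: real
  assumes "\<mu> > -1"
  shows "log_convex_seq (bessel_a \<mu>)"
  unfolding log_convex_seq_def
proof (intro allI impI)
  fix n :: nat assume "n \<ge> 2"
  then obtain m where n: "n = Suc (Suc m)" by (metis Suc_le_D numeral_2_eq_2 Suc_le_mono)
  define f where "f k = 1 / (bessel_zero \<mu> (Suc k))\<^sup>2" for k
  define A B C where "A = (\<Sum>k. f k ^ Suc m)" and "B = (\<Sum>k. f k ^ Suc (Suc m))"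
    and "C = (\<Sum>k. f k ^ Suc (Suc (Suc m)))"
  define P where "P = pochhammer (\<mu> + 1) (Suc m)"
  (* K is the common factor of both sides; what remains of the factorial and the Pochhammer symbol
     is (m + 1) (mu + m + 2) on the left and the larger (m + 2) (mu + m + 3) on the right *)
  define K where "K = (2 ^ (2 * m + 5) * fact m * P)\<^sup>2 * real (Suc m) * (\<mu> + real m + 2)"
  have zeta: "bessel_zeta \<mu> (real (2 * Suc m)) = A"
    "bessel_zeta \<mu> (real (2 * Suc (Suc m))) = B"
    "bessel_zeta \<mu> (real (2 * Suc (Suc (Suc m)))) = C"
    unfolding bessel_zeta_even[OF assms] A_def B_def C_def f_def by (rule refl)+
  have f_pos: "f k > 0" for k
    unfolding f_def using bessel_zero_pos[OF assms, of k] by (simp del: bessel_zero.simps)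
  have f_sum: "summable (\<lambda>k. f k ^ Suc i)" for i
    unfolding f_def by (rule summable_bessel_zero_powers[OF assms])
  have BAC: "B\<^sup>2 \<le> A * C"
    unfolding A_def B_def C_def by (intro suminf_powers_log_convex f_pos f_sum)
  have mu: "\<mu> + real m + 2 > 0" using assms by simp
  have P2: "pochhammer (\<mu> + 1) (Suc (Suc m)) = P * (\<mu> + real m + 2)"
    unfolding P_def by (subst pochhammer_Suc) (simp add: algebra_simps)
  have P3: "pochhammer (\<mu> + 1) (Suc (Suc (Suc m))) = P * (\<mu> + real m + 2) * (\<mu> + real m + 3)"
    by (subst pochhammer_Suc, subst P2) (simp add: algebra_simps)
  have fct: "fact (Suc m) = real (Suc m) * fact m"
    "fact (Suc (Suc m)) = real (Suc (Suc m)) * (real (Suc m) * fact m)"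
    by (simp_all only: fact_Suc)
  have idx: "Suc m - 1 = m" "Suc (Suc m) - 1 = Suc m" "Suc (Suc (Suc m)) - 1 = Suc (Suc m)"
    "n - 1 = Suc m" "n + 1 = Suc (Suc (Suc m))" by (simp_all add: n)
  have pw: "(2::real) ^ (2 * Suc m + 1) = 2 ^ (2 * m + 5) / 4"
    "(2::real) ^ (2 * Suc (Suc m) + 1) = 2 ^ (2 * m + 5)"
    "(2::real) ^ (2 * Suc (Suc (Suc m)) + 1) = 4 * 2 ^ (2 * m + 5)"
    by (simp_all add: power_add)
  have "(bessel_a \<mu> n)\<^sup>2 = K * (real (Suc m) * (\<mu> + real m + 2) * B\<^sup>2)"
    unfolding n bessel_a_def zeta P2 fct idx pw K_def by (simp only: power2_eq_square mult_ac)
  also have "\<dots> \<le> K * (real (Suc (Suc m)) * (\<mu> + real m + 3) * (A * C))"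
    using mu BAC by (intro mult_left_mono mult_mono) (auto simp: K_def)
  also have "\<dots> = bessel_a \<mu> (n - 1) * bessel_a \<mu> (n + 1)"
    unfolding idx bessel_a_def zeta P3 fct pw K_def P_def[symmetric]
    by (simp add: power2_eq_square mult_ac del: of_nat_Suc)
  finally show "(bessel_a \<mu> n)\<^sup>2 \<le> bessel_a \<mu> (n - 1) * bessel_a \<mu> (n + 1)" .
qed

end
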